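(* Let $X$ be a set, $X^{-1}=\{x^{-1}\mid x\in X\}$ with $X\cap X^{-1}=\varnothing$, let $<$ be a well ordering on $Y=X\cup X^{-1}$, and denote also by $<$ the corresponding deg-lex ordering of $Y^*$. Let $\mathcal{FI}(X)$ be the free inverse semigroup (with identity) generated by $X$. Let $S\subset Y^*\times Y^*$ be the set of the following defining relations (a) and (b): (a) $(ef,fe)$, where both $e$ and $f$ are ordered prime canonical idempotents, $ef$ is a canonical idempotent and $fe<ef$; (b) $(x^{-1}e'xf'x^{-1},\ f'x^{-1}e')$, where $x\in Y$ and both $x^{-1}e'x$ and $xf'x^{-1}$ are ordered prime canonical idempotents. Then $S$ is a Gröbner–Shirshov basis for the free inverse semigroup $\mathcal{FI}(X)$ with respect to the deg-lex ordering of $Y^*$; that is, $\mathcal{FI}(X)=\mathrm{sgp}\langle Y\mid S\rangle$ and every composition of relations from $S$ is trivial modulo $S$ and the corresponding word $w$.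
   Context: $Y^*$ is the free monoid on $Y$, with empty word $1$; $|w|$ is the length of $w$. Put $1^{-1}=1$, $(x^{-1})^{-1}=x$ for $x\in X$, and $(y_1\cdots y_n)^{-1}=y_n^{-1}\cdots y_1^{-1}$ for $y_i\in Y$. The deg-lex ordering compares two words first by length and then lexicographically. For a set of pairs $R\subseteq Y^*\times Y^*$, $\mathrm{sgp}\langle Y\mid R\rangle$ is the quotient of $Y^*$ by the congruence generated by $R$. The free inverse semigroup (with identity) on $X$ is $$\mathcal{FI}(X)=\mathrm{sgp}\langle Y\mid aa^{-1}a=a,\ aa^{-1}bb^{-1}=bb^{-1}aa^{-1},\ a,b\in Y^*\rangle .$$ The equality $\mathcal{FI}(X)=\mathrm{sgp}\langle Y\mid S\rangle$ means that the two congruences on $Y^*$ coincide. Formal idempotents (words in $Y^*$) are defined inductively: (i) The empty word $1$ is an idempotent, a canonical idempotent and an ordered canonical idempotent; it has no factors. (ii) If $h$ is an idempotent and $x\in Y$, then $x^{-1}hx$ is an idempotent and a prime idempotent. If $h$ is a canonical idempotent, $x\in Y$, and the first letters of the factors of $h$ are all different from $x$, then $x^{-1}hx$ is a canonical idempotent and a prime canonical idempotent; it is its own (only) factor. If moreover $h$ is an ordered canonical idempotent, then $x^{-1}hx$ is an ordered canonical idempotent and an ordered prime canonical idempotent. (iii) If $e_1,\dots,e_m$ ($m>1$) are prime idempotents, then $e=e_1\cdots e_m$ is an idempotent. If moreover $e_1,\dots,e_m$ are prime canonical idempotents whose first letters are pairwise distinct, then $e$ is a canonical idempotent and $e_1,\dots,e_m$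 are its factors. If in addition $e_1,\dots,e_m$ are ordered canonical idempotents and $e\le e_{i_1}\cdots e_{i_m}$ for every permutation $(i_1,\dots,i_m)$ of $(1,\dots,m)$, then $e$ is an ordered canonical idempotent. Gröbner–Shirshov bases. Let $S\subseteq Y^*\times Y^*$ be a set of pairs $(u,v)$ with $v<u$. An $S$-elementary transformation is $aub\mapsto avb$ or $avb\mapsto aub$ with $(u,v)\in S$, $a,b\in Y^*$. For $w\in Y^*$, write $p\equiv q \bmod (S,w)$ if there is a sequence of $S$-elementary transformations $p=u_0\mapsto u_1\mapsto\cdots\mapsto u_k=q$ with $u_i<w$ for all $0\le i\le k$. For $(u,v),(u',v')\in S$: if $w=ub=au'$ with $a,b\in Y^*$ and $|u|+|u'|>|w|$, the pair $(vb,av')$ is the intersection composition with respect to $w$; if $w=u=au'b$ with $a,b\in Y^*$, the pair $(v,av'b)$ is the inclusion composition with respect to $w$. A composition $(p,q)$ with respect to $w$ is trivial if $p\equiv q\bmod (S,w)$. $S$ is a Gröbner–Shirshov basis in $Y^*$, and for the semigroup $\mathrm{sgp}\langle Y\mid S\rangle$, if every composition of relations from $S$ is trivial. *)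

theory Defs
  imports "HOL-Library.Multiset"
begin

section \<open>Words over an alphabet with formal inverses\<close>

text \<open>
  Two constructors make the set \<open>X\<close> of generators and the set of their formal inverses
  disjoint.  The set \<open>X\<close> is an arbitrary (possibly empty) set; words over \<open>Y\<close> are the
  elements of \<^term>\<open>lists Y\<close>.
\<close>

datatype 'a letter = Gen 'a | GenInv 'a

type_synonym 'a word = "'a letter list"

fun letter_inv :: "'a letter \<Rightarrow> 'a letter" where
  "letter_inv (Gen x) = GenInv x"
| "letter_inv (GenInv x) = Gen x"

definition word_inv :: "'a word \<Rightarrow> 'a word" where
  "word_inv w = rev (map letter_inv w)"

definition alphabet :: "'a set \<Rightarrow> 'a letter set" where
  "alphabet X = Gen ` X \<union> GenInv ` X"

text \<open>
  Well orderings are reflexive relations, as in the library (\<^const>\<open>well_order_on\<close>), whereas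
  the following deg-lex ordering is strict.
\<close>

definition deglex :: "('b \<times> 'b) set \<Rightarrow> ('b list \<times> 'b list) set" where
  "deglex r = lenlex (r - Id)"


section \<open>Semigroup presentations\<close>

text \<open>
  The congruence on \<^term>\<open>lists Y\<close> generated by \<open>R\<close>.  The presented semigroup is
  \<^term>\<open>lists Y\<close> modulo this congruence.
\<close>

inductive_set generated_congruence :: "'b set \<Rightarrow> ('b list \<times> 'b list) set \<Rightarrow> ('b list \<times> 'b list) set"
  for Y :: "'b set" and R :: "('b list \<times> 'b list) set" where
  base: "(u, v) \<in> R \<Longrightarrow> u \<in> lists Y \<Longrightarrow> v \<in> lists Y \<Longrightarrow> (u, v) \<in> generated_congruence Y R"
| refl: "u \<in> lists Y \<Longrightarrow> (u, u) \<in> generated_congruence Y R"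
| sym: "(u, v) \<in> generated_congruence Y R \<Longrightarrow> (v, u) \<in> generated_congruence Y R"
| trans: "(u, v) \<in> generated_congruence Y R \<Longrightarrow> (v, w) \<in> generated_congruence Y R \<Longrightarrow>
    (u, w) \<in> generated_congruence Y R"
| mult: "(u, v) \<in> generated_congruence Y R \<Longrightarrow> (u', v') \<in> generated_congruence Y R \<Longrightarrow>
    (u @ u', v @ v') \<in> generated_congruence Y R"

definition free_inverse_relations :: "'a set \<Rightarrow> ('a word \<times> 'a word) set" where
  "free_inverse_relations X =
     {(a @ word_inv a @ a, a) | a. a \<in> lists (alphabet X)} \<union>
     {(a @ word_inv a @ b @ word_inv b, b @ word_inv b @ a @ word_inv a) | a b.
        a \<in> lists (alphabet X) \<and> b \<in> lists (alphabet X)}"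


section \<open>Formal idempotents\<close>

text \<open>
  \<^term>\<open>canonical Y w es\<close> means that the word \<open>w\<close> is a canonical idempotent with list of
  factors \<open>es\<close>.  The list is carried as an argument because the factors belong to the inductive
  construction of \<open>w\<close>; mathematically they are determined by \<open>w\<close>, being the pieces between
  consecutive prefixes of \<open>w\<close> that are trivial in the free group.
\<close>

inductive canonical :: "'a letter set \<Rightarrow> 'a word \<Rightarrow> 'a word list \<Rightarrow> bool"
  and prime_canonical :: "'a letter set \<Rightarrow> 'a word \<Rightarrow> bool"
  for Y :: "'a letter set" where
  canonical_empty: "canonical Y [] []"
| prime_canonical_conj: "canonical Y h es \<Longrightarrow> x \<in> Y \<Longrightarrow> \<forall>e \<in> set es. hd e \<noteq> x \<Longrightarrow>
    prime_canonical Y (letter_inv x # h @ [x])"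
| canonical_prime: "prime_canonical Y e \<Longrightarrow> canonical Y e [e]"
| canonical_prod: "length es > 1 \<Longrightarrow> \<forall>e \<in> set es. prime_canonical Y e \<Longrightarrow>
    distinct (map hd es) \<Longrightarrow> canonical Y (concat es) es"

definition canonical_idempotent :: "'a letter set \<Rightarrow> 'a word \<Rightarrow> bool" where
  "canonical_idempotent Y w \<longleftrightarrow> (\<exists>es. canonical Y w es)"

text \<open>The lists \<open>fs\<close> below are the rearrangements of \<open>es\<close>.\<close>

inductive ordered_canonical :: "('a letter \<times> 'a letter) set \<Rightarrow> 'a letter set \<Rightarrow> 'a word \<Rightarrow> bool"
  and ordered_prime_canonical :: "('a letter \<times> 'a letter) set \<Rightarrow> 'a letter set \<Rightarrow> 'a word \<Rightarrow> bool"
  for r :: "('a letter \<times> 'a letter) set" and Y :: "'a letter set" where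
  ordered_empty: "ordered_canonical r Y []"
| ordered_prime_conj: "canonical Y h es \<Longrightarrow> x \<in> Y \<Longrightarrow> \<forall>e \<in> set es. hd e \<noteq> x \<Longrightarrow>
    ordered_canonical r Y h \<Longrightarrow> ordered_prime_canonical r Y (letter_inv x # h @ [x])"
| ordered_prime: "ordered_prime_canonical r Y e \<Longrightarrow> ordered_canonical r Y e"
| ordered_prod: "length es > 1 \<Longrightarrow>
    \<forall>e \<in> set es. prime_canonical Y e \<and> ordered_canonical r Y e \<Longrightarrow>
    distinct (map hd es) \<Longrightarrow>
    \<forall>fs. mset fs = mset es \<longrightarrow> (concat es, concat fs) \<in> (deglex r)\<^sup>= \<Longrightarrow>
    ordered_canonical r Y (concat es)"


section \<open>Groebner--Shirshov bases\<close>

definition elementary_transformation ::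
  "'b set \<Rightarrow> ('b list \<times> 'b list) set \<Rightarrow> ('b list \<times> 'b list) set" where
  "elementary_transformation Y S =
     {(a @ u @ b, a @ v @ b) | a b u v. a \<in> lists Y \<and> b \<in> lists Y \<and> (u, v) \<in> S} \<union>
     {(a @ v @ b, a @ u @ b) | a b u v. a \<in> lists Y \<and> b \<in> lists Y \<and> (u, v) \<in> S}"

text \<open>Congruence of \<open>p\<close> and \<open>q\<close> modulo \<open>(S, w)\<close>, where \<open>lt\<close> is the strict ordering of words.\<close>

definition congruent_mod ::
  "('b list \<times> 'b list) set \<Rightarrow> 'b set \<Rightarrow> ('b list \<times> 'b list) set \<Rightarrow> 'b list \<Rightarrow> 'b list \<Rightarrow> 'b list \<Rightarrow> bool"
where
  "congruent_mod lt Y S w p q \<longleftrightarrow>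
     (\<exists>(k :: nat) u. u 0 = p \<and> u k = q \<and>
        (\<forall>i < k. (u i, u (Suc i)) \<in> elementary_transformation Y S) \<and>
        (\<forall>i \<le> k. u i \<in> lists Y \<and> (u i, w) \<in> lt))"

definition intersection_compositions ::
  "'b set \<Rightarrow> ('b list \<times> 'b list) set \<Rightarrow> ('b list \<times> 'b list \<times> 'b list) set" where
  "intersection_compositions Y S =
     {(w, v @ b, a @ v') | w u v u' v' a b.
        (u, v) \<in> S \<and> (u', v') \<in> S \<and> a \<in> lists Y \<and> b \<in> lists Y \<and>
        w = u @ b \<and> w = a @ u' \<and> length u + length u' > length w}"

definition inclusion_compositions ::
  "'b set \<Rightarrow> ('b list \<times> 'b list) set \<Rightarrow> ('b list \<times> 'b list \<times> 'b list) set" where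
  "inclusion_compositions Y S =
     {(w, v, a @ v' @ b) | w u v u' v' a b.
        (u, v) \<in> S \<and> (u', v') \<in> S \<and> a \<in> lists Y \<and> b \<in> lists Y \<and>
        w = u \<and> w = a @ u' @ b}"

text \<open>The first two conjuncts are the standing assumptions on the set \<open>S\<close> of relations.\<close>

definition Groebner_Shirshov_basis ::
  "('b list \<times> 'b list) set \<Rightarrow> 'b set \<Rightarrow> ('b list \<times> 'b list) set \<Rightarrow> bool" where
  "Groebner_Shirshov_basis lt Y S \<longleftrightarrow>
     S \<subseteq> lists Y \<times> lists Y \<and>
     (\<forall>(u, v) \<in> S. (v, u) \<in> lt) \<and>
     (\<forall>(w, p, q) \<in> intersection_compositions Y S \<union> inclusion_compositions Y S.
        congruent_mod lt Y S w p q)"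


section \<open>The defining relations of the free inverse semigroup\<close>

definition relations_a ::
  "('a letter \<times> 'a letter) set \<Rightarrow> 'a letter set \<Rightarrow> ('a word \<times> 'a word) set" where
  "relations_a r Y =
     {(e @ f, f @ e) | e f.
        ordered_prime_canonical r Y e \<and> ordered_prime_canonical r Y f \<and>
        canonical_idempotent Y (e @ f) \<and> (f @ e, e @ f) \<in> deglex r}"

definition relations_b ::
  "('a letter \<times> 'a letter) set \<Rightarrow> 'a letter set \<Rightarrow> ('a word \<times> 'a word) set" where
  "relations_b r Y =
     {(letter_inv x # e' @ [x] @ f' @ [letter_inv x], f' @ [letter_inv x] @ e') | x e' f'.
        x \<in> Y \<and> e' \<in> lists Y \<and> f' \<in> lists Y \<and>
        ordered_prime_canonical r Y (letter_inv x # e' @ [x]) \<and>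
        ordered_prime_canonical r Y (x # f' @ [letter_inv x])}"

end

theory Submission
  imports Defs
begin

text \<open>
  The proof avoids all case distinctions on overlaps.  Read the relations \<open>S\<close> as a rewriting
  system on \<^term>\<open>lists Y\<close>.  Every rule decreases a word in the deg-lex ordering, which is
  well founded, so every word reduces to an irreducible one.  If both sides of a composition with
  respect to \<open>w\<close> reduce to the same irreducible word, then the two reductions form a chain
  of elementary transformations that stays below \<open>w\<close>, because both start below \<open>w\<close> and only
  descend.  Since \<open>S\<close> holds in the free inverse semigroup, where formal idempotents commute
  (\<open>relations_a_in_FI\<close>, \<open>relations_b_in_FI\<close>), it suffices that each element of the free inverse
  semigroup is represented by only one irreducible word.  The same fact shows that \<open>S\<close> implies
  the defining relations of the free inverse semigroup.

  The irreducible word is unique because it can be read off an invariant, the Munn tree.  A word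
  over \<open>Y\<close> is a walk in the Cayley graph of the free group, which is a tree; its Munn tree is
  the finite subtree of the vertices visited, together with the end of the walk.  The relations of
  the free inverse semigroup preserve it (\<open>free_inverse_same_Munn_tree\<close>).

  A canonical idempotent walks once around a finite tree, down and up each edge exactly once, and
  it is ordered if the branches at each vertex are visited in increasing order of their first
  letters.  An irreducible word follows the geodesic from the origin to the end of the walk and
  makes at each vertex of it an ordered tour of the branches that leave the geodesic there
  (\<open>irreducible_spine_tour\<close>): a repeated branch, or a branch along an edge of the geodesic, would
  create the left side of a relation (b), and two adjacent branches in the wrong order would form
  the left side of a relation (a).  Such a
  walk is determined by the tree and its end (\<open>spine_tour_determined\<close>), as at each vertex there
  is no choice left.
\<close>

section \<open>Presentations and words\<close>

lemma letter_inv_letter_inv [simp]: "letter_inv (letter_inv x) = x"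
  by (cases x) auto

lemma letter_inv_in_alphabet [simp]: "letter_inv x \<in> alphabet X \<longleftrightarrow> x \<in> alphabet X"
  by (cases x) (auto simp: alphabet_def)

lemma word_inv_Nil [simp]: "word_inv [] = []"
  by (simp add: word_inv_def)

lemma word_inv_Cons [simp]: "word_inv (x # w) = word_inv w @ [letter_inv x]"
  by (simp add: word_inv_def)

lemma word_inv_append [simp]: "word_inv (u @ v) = word_inv v @ word_inv u"
  by (simp add: word_inv_def)

lemma word_inv_word_inv [simp]: "word_inv (word_inv w) = w"
  by (induction w) auto

lemma word_inv_in_lists [simp]: "word_inv w \<in> lists (alphabet X) \<longleftrightarrow> w \<in> lists (alphabet X)"
  by (induction w) auto

lemma generated_congruence_in_lists:
  "(u, v) \<in> generated_congruence Y R \<Longrightarrow> u \<in> lists Y \<and> v \<in> lists Y"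
  by (induction rule: generated_congruence.induct) auto

lemma generated_congruence_mono:
  assumes "R \<subseteq> generated_congruence Y R'"
  shows "generated_congruence Y R \<subseteq> generated_congruence Y R'"
proof (rule subrelI)
  fix u v assume "(u, v) \<in> generated_congruence Y R"
  then show "(u, v) \<in> generated_congruence Y R'"
    by induction (use assms in \<open>auto intro: generated_congruence.intros\<close>)
qed

lemma elementary_transformation_congruent:
  assumes "(u, v) \<in> S" "S \<subseteq> lists Y \<times> lists Y" "a \<in> lists Y" "b \<in> lists Y"
  shows "(a @ u @ b, a @ v @ b) \<in> generated_congruence Y S"
  using assms by (blast intro: generated_congruence.intros)

lemma congruent_mod_if_rtrancl:
  assumes "(p, q) \<in> (elementary_transformation Y S \<inter> B \<times> B)\<^sup>*"
    and B: "B = {v \<in> lists Y. (v, w) \<in> lt}" and "p \<in> B"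
  shows "congruent_mod lt Y S w p q"
proof -
  obtain k where "(p, q) \<in> (elementary_transformation Y S \<inter> B \<times> B) ^^ k"
    using assms(1) rtrancl_imp_relpow by blast
  then obtain u where u: "u 0 = p" "u k = q"
    "\<forall>i<k. (u i, u (Suc i)) \<in> elementary_transformation Y S \<inter> B \<times> B"
    by (auto simp: relpow_fun_conv)
  have "u i \<in> B" if "i \<le> k" for i
    using u \<open>p \<in> B\<close> that by (cases i) auto
  with u show ?thesis
    unfolding congruent_mod_def B by blast
qed


section \<open>The Munn tree of a word\<close>

text \<open>
  Vertices of the Cayley tree of the free group are reduced words, written backwards as stacks: the
  last letter of the reduced word is the head of the list, and the list below it is the parent
  vertex.  The walk along a letter pushes it onto the stack or cancels the head.
\<close>
fun push :: "'a letter \<Rightarrow> 'a word \<Rightarrow> 'a word" where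
  "push x [] = [x]"
| "push x (y # s) = (if y = letter_inv x then s else x # y # s)"

fun walk_end :: "'a word \<Rightarrow> 'a word \<Rightarrow> 'a word" where
  "walk_end s [] = s"
| "walk_end s (x # w) = walk_end (push x s) w"

fun visited :: "'a word \<Rightarrow> 'a word \<Rightarrow> 'a word set" where
  "visited s [] = {s}"
| "visited s (x # w) = insert s (visited (push x s) w)"

fun freely_reduced :: "'a word \<Rightarrow> bool" where
  "freely_reduced [] \<longleftrightarrow> True"
| "freely_reduced (x # s) \<longleftrightarrow> (case s of [] \<Rightarrow> True | y # t \<Rightarrow> y \<noteq> letter_inv x) \<and> freely_reduced s"

lemma push_letter_inv_Cons [simp]: "push (letter_inv x) (x # s) = s"
  by simp

lemma freely_reduced_push: "freely_reduced s \<Longrightarrow> freely_reduced (push x s)"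
  by (cases s) auto

text \<open>
  On a stack that is not reduced this fails: \<open>x\<close> may cancel a head under which
  another \<open>x\<close> lies, and the way back then cancels that \<open>x\<close> instead of restoring the head.
\<close>
lemma push_letter_inv_push: "freely_reduced s \<Longrightarrow> push (letter_inv x) (push x s) = s"
  by (cases s; cases "tl s") auto

lemma freely_reduced_walk_end: "freely_reduced s \<Longrightarrow> freely_reduced (walk_end s w)"
  by (induction w arbitrary: s) (auto simp: freely_reduced_push)

lemma walk_end_append [simp]: "walk_end s (u @ v) = walk_end (walk_end s u) v"
  by (induction u arbitrary: s) auto

lemma start_in_visited [simp]: "s \<in> visited s w"
  by (cases w) auto

lemma end_in_visited [simp]: "walk_end s w \<in> visited s w"
  by (induction w arbitrary: s) auto

lemma visited_append [simp]: "visited s (u @ v) = visited s u \<union> visited (walk_end s u) v"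
  by (induction u arbitrary: s) (auto simp: insert_absorb)

lemma walk_end_word_inv:
  "freely_reduced s \<Longrightarrow> walk_end (walk_end s w) (word_inv w) = s"
  by (induction w arbitrary: s) (auto simp: freely_reduced_push push_letter_inv_push)

lemma visited_word_inv:
  "freely_reduced s \<Longrightarrow> visited (walk_end s w) (word_inv w) = visited s w"
  by (induction w arbitrary: s)
    (auto simp: freely_reduced_push push_letter_inv_push walk_end_word_inv)

text \<open>
  Quantifying over all starting vertices makes this a congruence by its very form, whereas for
  walks from the origin alone one would need the action of the free group on its Cayley tree.
\<close>
definition same_Munn_tree :: "'a word \<Rightarrow> 'a word \<Rightarrow> bool" where
  "same_Munn_tree u v \<longleftrightarrow>
     (\<forall>s. freely_reduced s \<longrightarrow> visited s u = visited s v \<and> walk_end s u = walk_end s v)"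

text \<open>
  The walk along \<open>a a\<^sup>-\<^sup>1\<close> visits what \<open>a\<close> visits and returns to its start.  So both sides of
  either kind of relation visit the same vertices: those of \<open>a\<close> alone, or those of \<open>a\<close> and \<open>b\<close>.
\<close>
lemma free_inverse_same_Munn_tree:
  assumes "(u, v) \<in> generated_congruence Y (free_inverse_relations X)"
  shows "same_Munn_tree u v"
  using assms
proof induction
  case (base u v)
  then show ?case
    by (auto simp: free_inverse_relations_def same_Munn_tree_def walk_end_word_inv
        visited_word_inv freely_reduced_walk_end)
qed (auto simp: same_Munn_tree_def freely_reduced_walk_end)


section \<open>Canonical idempotents are idempotents of the free inverse semigroup\<close>

lemma prime_canonical_if_ordered: "ordered_prime_canonical r Y w \<Longrightarrow> prime_canonical Y w"
  by (erule ordered_prime_canonical.cases) (auto intro: prime_canonical_conj)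

lemma ordered_prime_canonicalE:
  assumes "ordered_prime_canonical r Y (y # h @ [x])"
  obtains "y = letter_inv x" "x \<in> Y" "canonical_idempotent Y h"
  using assms by cases (auto simp: canonical_idempotent_def)

context
  fixes X :: "'a set"
begin

abbreviation FI :: "('a word \<times> 'a word) set" where
  "FI \<equiv> generated_congruence (alphabet X) (free_inverse_relations X)"

abbreviation W :: "'a word set" where
  "W \<equiv> lists (alphabet X)"

text \<open>
  The idempotents of an inverse semigroup are the elements \<open>a a\<^sup>-\<^sup>1\<close>.  These commute by a
  defining relation, so it suffices to bring formal idempotents to this form.
\<close>
definition range_word :: "'a word \<Rightarrow> bool" where
  "range_word w \<longleftrightarrow> (\<exists>a \<in> W. (w, a @ word_inv a) \<in> FI)"

lemma FI_context:
  assumes "(u, v) \<in> FI" "a \<in> W" "b \<in> W"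
  shows "(a @ u @ b, a @ v @ b) \<in> FI"
  using assms by (blast intro: generated_congruence.intros)

lemma FI_regular: "a \<in> W \<Longrightarrow> (a @ word_inv a @ a, a) \<in> FI"
  by (rule generated_congruence.base) (auto simp: free_inverse_relations_def simp del: append_assoc)

lemma FI_ranges_commute:
  "a \<in> W \<Longrightarrow> b \<in> W \<Longrightarrow>
    (a @ word_inv a @ b @ word_inv b, b @ word_inv b @ a @ word_inv a) \<in> FI"
  by (rule generated_congruence.base) (auto simp: free_inverse_relations_def simp del: append_assoc)

lemma range_words_commute:
  assumes "range_word e" "range_word f"
  shows "(e @ f, f @ e) \<in> FI"
proof -
  obtain a b where ab: "a \<in> W" "b \<in> W" "(e, a @ word_inv a) \<in> FI" "(f, b @ word_inv b) \<in> FI"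
    using assms by (auto simp: range_word_def)
  have "(e @ f, (a @ word_inv a) @ (b @ word_inv b)) \<in> FI"
    using ab by (blast intro: generated_congruence.mult)
  moreover have "((a @ word_inv a) @ (b @ word_inv b), (b @ word_inv b) @ (a @ word_inv a)) \<in> FI"
    using FI_ranges_commute ab by simp
  moreover have "((b @ word_inv b) @ (a @ word_inv a), f @ e) \<in> FI"
    using ab by (blast intro: generated_congruence.mult generated_congruence.sym)
  ultimately show ?thesis
    by (blast intro: generated_congruence.trans)
qed

lemma range_word_Nil: "range_word []"
  unfolding range_word_def by (rule bexI[of _ "[]"]) (auto intro: generated_congruence.refl)

lemma range_word_conj:
  assumes "range_word h" "x \<in> alphabet X"
  shows "range_word (letter_inv x # h @ [x])"
proof -
  obtain a where a: "a \<in> W" "(h, a @ word_inv a) \<in> FI"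
    using assms by (auto simp: range_word_def)
  have "([letter_inv x] @ h @ [x], [letter_inv x] @ (a @ word_inv a) @ [x]) \<in> FI"
    using a assms(2) by (intro FI_context) auto
  then show ?thesis
    unfolding range_word_def
    using a assms(2) by (intro bexI[of _ "letter_inv x # a"]) auto
qed

text \<open>
  A product of ranges \<open>a a\<^sup>-\<^sup>1 b b\<^sup>-\<^sup>1\<close> is the range of \<open>c = a a\<^sup>-\<^sup>1 b\<close>: the word
  \<open>c c\<^sup>-\<^sup>1\<close> has a second copy of \<open>a a\<^sup>-\<^sup>1\<close> at its end, which commutes to the front
  and is absorbed there.
\<close>
lemma range_word_append:
  assumes "range_word e" "range_word f"
  shows "range_word (e @ f)"
proof -
  obtain a b where ab: "a \<in> W" "b \<in> W" "(e, a @ word_inv a) \<in> FI" "(f, b @ word_inv b) \<in> FI"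
    using assms by (auto simp: range_word_def)
  let ?c = "a @ word_inv a @ b"
  have "(e @ f, (a @ word_inv a) @ (b @ word_inv b)) \<in> FI"
    using ab by (blast intro: generated_congruence.mult)
  moreover have "((a @ word_inv a @ a) @ (word_inv a @ b @ word_inv b),
      a @ (word_inv a @ b @ word_inv b)) \<in> FI"
    using ab by (intro generated_congruence.mult FI_regular generated_congruence.refl) auto
  moreover have "((a @ word_inv a) @ (a @ word_inv a @ b @ word_inv b),
      (a @ word_inv a) @ (b @ word_inv b @ a @ word_inv a)) \<in> FI"
    using ab by (intro generated_congruence.mult FI_ranges_commute generated_congruence.refl) auto
  ultimately have "(e @ f, ?c @ word_inv ?c) \<in> FI"
    unfolding append_assoc word_inv_append word_inv_word_inv
    by (meson generated_congruence.trans generated_congruence.sym)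
  then show ?thesis
    unfolding range_word_def using ab by (intro bexI[of _ ?c]) (simp_all only: append_in_lists_conv word_inv_in_lists)
qed

lemma range_word_concat: "\<forall>e \<in> set es. range_word e \<Longrightarrow> range_word (concat es)"
  by (induction es) (auto intro: range_word_Nil range_word_append)

lemma range_word_canonical:
  "canonical (alphabet X) w es \<Longrightarrow> range_word w"
  "prime_canonical (alphabet X) w \<Longrightarrow> range_word w"
  by (induction rule: canonical_prime_canonical.inducts)
    (auto intro: range_word_Nil range_word_conj range_word_concat)

lemma relations_a_in_FI: "relations_a r (alphabet X) \<subseteq> FI"
  by (auto simp: relations_a_def
      intro!: range_words_commute range_word_canonical(2) prime_canonical_if_ordered)

text \<open>
  Write \<open>u \<sim> v\<close> for equality in the free inverse semigroup.  Moving the idempotent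
  \<open>x f' x\<^sup>-\<^sup>1\<close> to the left of \<open>e'\<close> and then \<open>x\<^sup>-\<^sup>1 x\<close> to the right of \<open>f'\<close> gives
  \<open>x\<^sup>-\<^sup>1 e' x f' x\<^sup>-\<^sup>1 \<sim> (x\<^sup>-\<^sup>1 x) f' x\<^sup>-\<^sup>1 e' \<sim> f' x\<^sup>-\<^sup>1 x x\<^sup>-\<^sup>1 e' \<sim> f' x\<^sup>-\<^sup>1 e'\<close>.
\<close>
lemma relations_b_in_FI: "relations_b r (alphabet X) \<subseteq> FI"
proof -
  have "(letter_inv x # e @ [x] @ f @ [letter_inv x], f @ [letter_inv x] @ e) \<in> FI"
    if x: "x \<in> alphabet X" and e: "range_word e" and f: "range_word f" for x e f
  proof -
    let ?y = "letter_inv x"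
    note refl = generated_congruence.refl
    have W: "e \<in> W" "f \<in> W"
      using e f generated_congruence_in_lists unfolding range_word_def by blast+
    have y: "range_word (x # f @ [?y])"
      using range_word_conj[OF f, of ?y] x by simp
    have "([?y] @ e @ (x # f @ [?y]), [?y] @ (x # f @ [?y]) @ e) \<in> FI"
      using x by (intro generated_congruence.mult refl range_words_commute e y) auto
    moreover have "((?y # [] @ [x]) @ f, f @ (?y # [] @ [x])) \<in> FI"
      using x by (intro range_words_commute f range_word_conj range_word_Nil)
    then have "(((?y # [] @ [x]) @ f) @ ([?y] @ e), (f @ (?y # [] @ [x])) @ ([?y] @ e)) \<in> FI"
      by (rule generated_congruence.mult[OF _ refl]) (use x W in auto)
    moreover have "(f @ ([?y] @ word_inv [?y] @ [?y]) @ e, f @ [?y] @ e) \<in> FI"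
      using x W by (intro FI_context FI_regular) auto
    ultimately show ?thesis
      by (auto intro: generated_congruence.trans)
  qed
  then show ?thesis
    unfolding relations_b_def
    by (force simp: canonical_idempotent_def
        elim!: ordered_prime_canonicalE intro: range_word_canonical(1))
qed

end


section \<open>Ordered tours\<close>

text \<open>
  A concatenation with increasing first letters precedes all its rearrangements: at the first
  position where the list of factors is changed, a later factor with a larger first letter moves in.
\<close>
lemma lenlex_concat_sorted_le:
  assumes "sorted_wrt (\<lambda>e f. (hd e, hd f) \<in> R) es" "\<forall>e \<in> set es. e \<noteq> []" "mset fs = mset es"
    and irrefl: "irrefl R"
  shows "(concat es, concat fs) \<in> (lenlex R)\<^sup>="
  using assms(1-3)
proof (induction es arbitrary: fs)
  case (Cons e es)
  then obtain f fs' where fs: "fs = f # fs'"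
    by (cases fs) auto
  have len: "length (concat fs) = length (concat (e # es))"
    using Cons.prems(3) by (metis length_concat mset_map sum_mset_sum_list)
  show ?case
  proof (cases "f = e")
    case True
    then have "(concat es, concat fs') \<in> (lenlex R)\<^sup>="
      using Cons fs by auto
    then show ?thesis
      using True fs irrefl by auto
  next
    case False
    then have "f \<in> set es"
      using Cons.prems(3) fs by (metis insert_iff list.set_intros(1) list.simps(15) set_mset_mset)
    then have "(hd e, hd f) \<in> R" "e \<noteq> []" "f \<noteq> []"
      using Cons.prems by auto
    then show ?thesis
      using len fs by (cases e; cases f) (auto simp: Cons_lenlex_iff)
  qed
qed auto

locale ordered_alphabet =
  fixes X :: "'a set" and Y :: "'a letter set" and r :: "('a letter \<times> 'a letter) set"
  assumes alphabet: "Y = alphabet X" and well_order: "well_order_on Y r"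
begin

definition precedes :: "'a letter \<Rightarrow> 'a letter \<Rightarrow> bool" (infix "\<prec>" 50) where
  "x \<prec> y \<longleftrightarrow> (x, y) \<in> r - Id"

definition S :: "('a word \<times> 'a word) set" where
  "S = relations_a r Y \<union> relations_b r Y"

lemma letter_inv_in_Y [simp]: "letter_inv x \<in> Y \<longleftrightarrow> x \<in> Y"
  by (simp add: alphabet)

lemma strict_order_trans: "trans (r - Id)"
  using well_order by (auto simp: well_order_on_def linear_order_on_def partial_order_on_def
      preorder_on_def intro!: trans_diff_Id)

lemma precedes_trans: "x \<prec> y \<Longrightarrow> y \<prec> z \<Longrightarrow> x \<prec> z"
  unfolding precedes_def using strict_order_trans by (rule transD)

lemma precedes_irrefl [simp]: "\<not> x \<prec> x"
  by (simp add: precedes_def)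

lemma precedes_total: "x \<in> Y \<Longrightarrow> y \<in> Y \<Longrightarrow> x \<noteq> y \<Longrightarrow> x \<prec> y \<or> y \<prec> x"
  using well_order
  by (auto simp: precedes_def well_order_on_def linear_order_on_def total_on_def)

lemma wf_deglex: "wf (deglex r)"
  using well_order by (auto simp: deglex_def well_order_on_def)

lemma deglex_trans: "trans (deglex r)"
  unfolding deglex_def using strict_order_trans by blast

text \<open>
  The words \<open>tour B w\<close> are the walks once around a finite tree in which the branches at the
  starting vertex have first letters in \<open>B\<close> and the branches at each vertex are visited in
  increasing order.  They are the ordered canonical idempotents, but the recursion on the
  first branch, with \<open>B\<close> restricted to the later letters, replaces lists of factors and
  comparisons of all permutations.
\<close>
inductive tour :: "'a letter set \<Rightarrow> 'a word \<Rightarrow> bool" where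
  tour_Nil: "tour B []"
| tour_Cons: "x \<in> B \<Longrightarrow> x \<in> Y \<Longrightarrow> tour (Y - {letter_inv x}) h \<Longrightarrow> tour {y \<in> B. x \<prec> y} g \<Longrightarrow>
    tour B (x # h @ letter_inv x # g)"

lemma tour_mono: "tour B w \<Longrightarrow> B \<subseteq> C \<Longrightarrow> tour C w"
proof (induction arbitrary: C rule: tour.induct)
  case (tour_Cons x B h g)
  then have "tour {y \<in> C. x \<prec> y} g"
    by (intro tour_Cons.IH) auto
  with tour_Cons show ?case
    by (intro tour.tour_Cons) auto
qed (rule tour_Nil)

text \<open>
  A tour visits the branch \<open>z\<close> at most once; the pieces before and after it avoid \<open>z\<close>.
\<close>
lemma tour_split:
  assumes "tour B w"
  shows "tour (B - {z}) w \<or>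
    (\<exists>a g b. w = a @ z # g @ letter_inv z # b \<and>
       tour (B - {z}) a \<and> tour (Y - {letter_inv z}) g \<and> tour (B - {z}) b)"
  using assms
proof induction
  case (tour_Cons x B h g)
  have eq: "{y \<in> B. x \<prec> y} - {z} = {y \<in> B - {z}. x \<prec> y}"
    by auto
  show ?case
  proof (cases "x = z")
    case True
    have "tour (B - {z}) g"
      using tour_Cons(4) by (rule tour_mono) (auto simp: True)
    with True tour_Cons show ?thesis
      by (intro disjI2 exI[of _ "[]"] exI[of _ h] exI[of _ g]) (auto intro: tour_Nil)
  next
    case False
    from tour_Cons.IH(2) show ?thesis
    proof (elim disjE exE conjE)
      assume "tour ({y \<in> B. x \<prec> y} - {z}) g"
      with False tour_Cons show ?thesis
        by (auto simp: eq intro!: tour.tour_Cons)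
    next
      fix a g' b
      assume g: "g = a @ z # g' @ letter_inv z # b" "tour ({y \<in> B. x \<prec> y} - {z}) a"
        "tour (Y - {letter_inv z}) g'" "tour ({y \<in> B. x \<prec> y} - {z}) b"
      have "tour (B - {z}) (x # h @ letter_inv x # a)"
        using False tour_Cons g by (auto simp: eq intro!: tour.tour_Cons)
      moreover have "tour (B - {z}) b"
        using g(4) by (rule tour_mono) auto
      ultimately show ?thesis
        using g by (intro disjI2 exI[of _ "x # h @ letter_inv x # a"] exI[of _ g'] exI[of _ b]) auto
    qed
  qed
qed (auto intro: tour_Nil)

lemma canonical_sorted:
  assumes "\<forall>e \<in> set es. ordered_prime_canonical r Y e" "sorted_wrt (\<lambda>e f. hd e \<prec> hd f) es"
  shows "canonical Y (concat es) es \<and> ordered_canonical r Y (concat es)"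
proof -
  have prime: "\<forall>e \<in> set es. prime_canonical Y e"
    using assms(1) prime_canonical_if_ordered by blast
  then have ne: "\<forall>e \<in> set es. e \<noteq> []"
    by (auto elim: prime_canonical.cases)
  have dist: "distinct (map hd es)"
    using assms(2) by (induction es) force+
  consider "es = []" | e where "es = [e]" | "length es > 1"
    by (cases es rule: remdups_adj.cases) auto
  then show ?thesis
  proof cases
    case 3
    have "\<forall>fs. mset fs = mset es \<longrightarrow> (concat es, concat fs) \<in> (deglex r)\<^sup>="
      unfolding deglex_def
      by (intro allI impI lenlex_concat_sorted_le[OF _ ne])
        (use assms(2) in \<open>auto simp: precedes_def irrefl_def\<close>)
    then show ?thesis
      using 3 prime dist assms(1) by (blast intro: canonical_prod ordered_prod ordered_prime)
  qed (use prime assms(1) in \<open>auto intro: canonical_empty ordered_empty canonical_prime ordered_prime\<close>)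
qed

lemma conjugate_sorted:
  assumes "\<forall>e \<in> set es. ordered_prime_canonical r Y e \<and> hd e \<noteq> letter_inv x"
    "sorted_wrt (\<lambda>e f. hd e \<prec> hd f) es" "x \<in> Y"
  shows "ordered_prime_canonical r Y (x # concat es @ [letter_inv x])"
  using canonical_sorted[of es] ordered_prime_conj[of Y "concat es" es "letter_inv x" r] assms by auto

lemma tour_factors:
  assumes "tour B w"
  obtains es where "w = concat es" "\<forall>e \<in> set es. hd e \<in> B \<and> ordered_prime_canonical r Y e"
    "sorted_wrt (\<lambda>e f. hd e \<prec> hd f) es"
proof -
  have "\<exists>es. w = concat es \<and> (\<forall>e \<in> set es. hd e \<in> B \<and> ordered_prime_canonical r Y e) \<and>
      sorted_wrt (\<lambda>e f. hd e \<prec> hd f) es"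
    using assms
  proof induction
    case (tour_Nil B)
    show ?case by (intro exI[of _ "[]"]) auto
  next
    case (tour_Cons x B h g)
    then obtain es fs where
      h: "h = concat es" "\<forall>e \<in> set es. hd e \<in> Y - {letter_inv x} \<and> ordered_prime_canonical r Y e"
        "sorted_wrt (\<lambda>e f. hd e \<prec> hd f) es" and
      g: "g = concat fs" "\<forall>e \<in> set fs. hd e \<in> {y \<in> B. x \<prec> y} \<and> ordered_prime_canonical r Y e"
        "sorted_wrt (\<lambda>e f. hd e \<prec> hd f) fs"
      by blast
    let ?e = "x # h @ [letter_inv x]"
    have "ordered_prime_canonical r Y ?e"
      unfolding h(1) using h(2,3) tour_Cons.hyps by (intro conjugate_sorted) auto
    then show ?case
      using g h(1) tour_Cons.hyps by (intro exI[of _ "?e # fs"]) auto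
  qed
  then show thesis
    using that by blast
qed

lemma prime_tour:
  assumes "tour (Y - {letter_inv x}) h" "x \<in> Y"
  shows "ordered_prime_canonical r Y (x # h @ [letter_inv x])"
proof -
  obtain es where es: "h = concat es" "\<forall>e \<in> set es. hd e \<in> Y - {letter_inv x} \<and> ordered_prime_canonical r Y e"
    "sorted_wrt (\<lambda>e f. hd e \<prec> hd f) es"
    using assms(1) by (rule tour_factors)
  then show ?thesis
    unfolding es(1) using assms(2) by (intro conjugate_sorted) auto
qed

lemma tour_in_lists: "tour B w \<Longrightarrow> w \<in> lists Y"
  by (induction rule: tour.induct) auto

text \<open>
  Relation (b) written for the inverse letter: a walk that goes along \<open>x\<close>, returns and goes along
  \<open>x\<close> again may postpone the branches \<open>a\<close> explored on the first visit to the second one.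
\<close>
lemma relation_b_tours:
  assumes "x \<in> Y" "tour (Y - {letter_inv x}) a" "tour (Y - {x}) g"
  shows "(x # a @ [letter_inv x] @ g @ [x], g @ [x] @ a) \<in> S"
proof -
  have "ordered_prime_canonical r Y (letter_inv x # g @ [x])"
    using prime_tour[of "letter_inv x" g] assms by simp
  moreover have "ordered_prime_canonical r Y (x # a @ [letter_inv x])"
    using assms by (intro prime_tour)
  ultimately have "(letter_inv (letter_inv x) # a @ [letter_inv x] @ g @ [letter_inv (letter_inv x)],
      g @ [letter_inv (letter_inv x)] @ a) \<in> relations_b r Y"
    unfolding relations_b_def using assms tour_in_lists
    by (intro CollectI exI[of _ "letter_inv x"] exI[of _ a] exI[of _ g]) auto
  then show ?thesis
    by (simp add: S_def)
qed

text \<open>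
  The first letters differ and the two products have the same length, so these letters alone decide
  which order of the factors is smaller.
\<close>
lemma relation_a_tours:
  assumes "x \<in> Y" "y \<in> Y" "tour (Y - {letter_inv x}) h" "tour (Y - {letter_inv y}) g" "y \<prec> x"
  shows "((x # h @ [letter_inv x]) @ (y # g @ [letter_inv y]),
    (y # g @ [letter_inv y]) @ (x # h @ [letter_inv x])) \<in> S"
proof -
  let ?e = "x # h @ [letter_inv x]" and ?f = "y # g @ [letter_inv y]"
  have ef: "ordered_prime_canonical r Y ?e" "ordered_prime_canonical r Y ?f"
    using assms by (auto intro: prime_tour)
  then have "canonical Y (concat [?e, ?f]) [?e, ?f]"
    using assms(5) by (intro canonical_prod) (auto dest: prime_canonical_if_ordered)
  then have "canonical_idempotent Y (?e @ ?f)"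
    unfolding canonical_idempotent_def by auto
  moreover have "(?f @ ?e, ?e @ ?f) \<in> deglex r"
    using assms(5) by (simp add: precedes_def deglex_def Cons_lenlex_iff)
  ultimately show ?thesis
    unfolding S_def relations_a_def using ef by blast
qed


section \<open>Irreducible words\<close>

definition irreducible :: "'a word \<Rightarrow> bool" where
  "irreducible w \<longleftrightarrow> w \<in> lists Y \<and> (\<forall>a b u v. (u, v) \<in> S \<longrightarrow> w \<noteq> a @ u @ b)"

lemma irreducible_in_lists: "irreducible w \<Longrightarrow> w \<in> lists Y"
  by (simp add: irreducible_def)

lemma irreducible_factor: "irreducible (a @ u @ b) \<Longrightarrow> irreducible u"
  unfolding irreducible_def by (metis append.assoc append_in_lists_conv)

text \<open>
  An irreducible walk that enters a vertex along \<open>x\<close> does not go back along \<open>x\<close> as part of a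
  tour: the tour would bring it to the vertex along \<open>x\<close> a second time, an instance of (b).
\<close>
lemma irreducible_Cons_tour:
  assumes "irreducible (x # h)" "tour B h" "B \<subseteq> Y"
  shows "tour (B - {letter_inv x}) h"
  using tour_split[OF assms(2), of "letter_inv x"]
proof (elim disjE exE conjE)
  fix a g b
  assume h: "h = a @ letter_inv x # g @ letter_inv (letter_inv x) # b"
    "tour (B - {letter_inv x}) a" "tour (Y - {letter_inv (letter_inv x)}) g"
  have "tour (Y - {letter_inv x}) a"
    using h(2) assms(3) by (auto intro: tour_mono)
  then have "(x # a @ [letter_inv x] @ g @ [x], g @ [x] @ a) \<in> S"
    using h(3) irreducible_in_lists[OF assms(1)] by (intro relation_b_tours) auto
  moreover have "x # h = [] @ (x # a @ [letter_inv x] @ g @ [x]) @ b"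
    using h(1) by simp
  ultimately show ?thesis
    using assms(1) unfolding irreducible_def by blast
qed

text \<open>
  Relation (a) forbids only a single inversion between neighbouring branches.  That is enough, since
  the branches of \<open>g\<close> increase already and only the first of them has to be compared with \<open>x\<close>.
\<close>
lemma irreducible_prepend_branch:
  assumes "irreducible (x # h @ letter_inv x # g)" "tour (Y - {letter_inv x}) h" "tour B g"
    and "x \<in> Y" "B \<subseteq> Y - {x}"
  shows "tour (insert x B) (x # h @ letter_inv x # g)"
proof -
  have "tour {y \<in> insert x B. x \<prec> y} g"
    using assms(3)
  proof cases
    case (tour_Cons y h' g')
    have "\<not> y \<prec> x"
    proof
      assume "y \<prec> x"
      then have "((x # h @ [letter_inv x]) @ (y # h' @ [letter_inv y]),
          (y # h' @ [letter_inv y]) @ (x # h @ [letter_inv x])) \<in> S"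
        using tour_Cons assms by (intro relation_a_tours) auto
      moreover have "x # h @ letter_inv x # g =
          [] @ ((x # h @ [letter_inv x]) @ (y # h' @ [letter_inv y])) @ g'"
        using tour_Cons by simp
      ultimately show False
        using assms(1) unfolding irreducible_def by blast
    qed
    then have "x \<prec> y"
      using precedes_total[of x y] tour_Cons assms by auto
    moreover have "tour {z \<in> {z \<in> insert x B. x \<prec> z}. y \<prec> z} g'"
      using \<open>tour {z \<in> B. y \<prec> z} g'\<close>
      by (rule tour_mono) (use \<open>x \<prec> y\<close> precedes_trans in blast)
    ultimately show ?thesis
      unfolding \<open>g = _\<close> using tour_Cons by (intro tour.tour_Cons) auto
  qed (simp add: tour_Nil)
  then show ?thesis
    using assms by (intro tour.tour_Cons) auto
qed

text \<open>
  In \<open>spine_tour B w xs\<close> the geodesic from start to end has the letters \<open>xs\<close>.  At each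
  vertex the tour avoids the two geodesic edges, the next one by the set \<open>B - {x}\<close> and the previous
  one by the set \<open>Y - {letter_inv x}\<close> passed on along the geodesic.
\<close>
inductive spine_tour :: "'a letter set \<Rightarrow> 'a word \<Rightarrow> 'a word \<Rightarrow> bool" where
  spine_end: "tour B h \<Longrightarrow> spine_tour B h []"
| spine_step: "x \<in> B \<Longrightarrow> x \<in> Y \<Longrightarrow> tour (B - {x}) h \<Longrightarrow> spine_tour (Y - {letter_inv x}) w xs \<Longrightarrow>
    spine_tour B (h @ x # w) (x # xs)"

text \<open>
  The walk is built up from its end.  A new first letter \<open>y\<close> extends the geodesic unless the
  geodesic of the remaining walk starts with \<open>y\<^sup>-\<^sup>1\<close>.  In that case \<open>y\<close>, the first tour and
  \<open>y\<^sup>-\<^sup>1\<close> form a new branch, which joins the tour at the next vertex.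
\<close>
lemma irreducible_spine_tour:
  "irreducible w \<Longrightarrow> \<exists>xs. spine_tour Y w xs"
proof (induction w)
  case Nil
  show ?case by (blast intro: spine_end tour_Nil)
next
  case (Cons y w)
  have y: "y \<in> Y"
    using irreducible_in_lists[OF Cons.prems] by simp
  have irr: "irreducible u" if "y # w = a @ u @ b" for a u b
    using Cons.prems irreducible_factor that by metis
  have "irreducible w"
    using irr[of "[y]" w "[]"] by simp
  then obtain xs where "spine_tour Y w xs"
    using Cons.IH by blast
  then show ?case
  proof cases
    case spine_end
    then have "tour (Y - {letter_inv y}) w"
      using Cons.prems irreducible_Cons_tour by blast
    then have "spine_tour Y ([] @ y # w) [y]"
      using y by (intro spine_step spine_tour.spine_end tour_Nil)
    then show ?thesis by auto
  next
    case (spine_step x h w2 xs2)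
    have "irreducible (y # h)"
      using irr[of "[]" "y # h" "x # w2"] spine_step by simp
    then have h: "tour (Y - {x} - {letter_inv y}) h"
      using irreducible_Cons_tour spine_step by blast
    show ?thesis
    proof (cases "x = letter_inv y")
      case False
      then have "spine_tour (Y - {letter_inv y}) (h @ x # w2) (x # xs2)"
        using h spine_step by (intro spine_tour.spine_step) (auto simp: Diff_insert2[symmetric] insert_commute)
      then have "spine_tour Y ([] @ y # (h @ x # w2)) (y # x # xs2)"
        by (rule spine_tour.spine_step[OF y y tour_Nil])
      then show ?thesis
        using spine_step by auto
    next
      case True
      then have h': "tour (Y - {letter_inv y}) h"
        using h by simp
      have w2: "spine_tour (Y - {y}) w2 xs2"
        using spine_step True by simp
      from w2 show ?thesis
      proof cases
        case spine_end
        then have "tour (insert y (Y - {y})) (y # h @ letter_inv y # w2)"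
          using Cons.prems spine_step True h' y by (intro irreducible_prepend_branch) auto
        then show ?thesis
          using spine_step True y by (auto simp: insert_absorb intro: spine_tour.spine_end)
      next
        case (spine_step z h2 w3 xs3)
        have "irreducible (y # h @ letter_inv y # h2)"
          using irr[of "[]" "y # h @ letter_inv y # h2" "z # w3"] \<open>w = _\<close> True spine_step by simp
        then have "tour (insert y (Y - {y} - {z})) (y # h @ letter_inv y # h2)"
          using spine_step h' y by (intro irreducible_prepend_branch) auto
        then have "tour (Y - {z}) (y # h @ letter_inv y # h2)"
          by (rule tour_mono) (use spine_step y in auto)
        then have "spine_tour Y ((y # h @ letter_inv y # h2) @ z # w3) (z # xs3)"
          using spine_step by (intro spine_tour.spine_step) auto
        then show ?thesis
          using \<open>w = _\<close> True spine_step by auto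
      qed
    qed
  qed
qed


section \<open>The Munn tree determines the irreducible word\<close>

definition beyond :: "'a word \<Rightarrow> 'a word set" where
  "beyond s = range (\<lambda>t. t @ s)"

text \<open>
  No letter of \<open>B\<close> leads from \<open>s\<close> back to its parent, so the letters of \<open>B\<close> lead to children.
\<close>
definition upward :: "'a letter set \<Rightarrow> 'a word \<Rightarrow> bool" where
  "upward B s \<longleftrightarrow> (\<forall>x \<in> B. push x s = x # s)"

lemma upward_child: "upward (Y - {letter_inv x}) (x # s)"
  by (auto simp: upward_def)

lemma upward_subset: "upward B s \<Longrightarrow> C \<subseteq> B \<Longrightarrow> upward C s"
  by (auto simp: upward_def)

lemma beyond_self [simp]: "s \<in> beyond s"
  by (auto simp: beyond_def image_iff)

lemma beyond_Cons_subset: "beyond (x # s) \<subseteq> beyond s"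
proof
  fix p assume "p \<in> beyond (x # s)"
  then obtain t where "p = (t @ [x]) @ s"
    by (auto simp: beyond_def)
  then show "p \<in> beyond s"
    unfolding beyond_def by blast
qed

lemma start_not_beyond_Cons [simp]: "s \<notin> beyond (x # s)"
proof
  assume "s \<in> beyond (x # s)"
  then obtain t where "s = t @ x # s"
    by (auto simp: beyond_def)
  from arg_cong[OF this, of length] show False
    by simp
qed

lemma beyond_siblings_disjoint: "p \<in> beyond (x # s) \<Longrightarrow> p \<in> beyond (y # s) \<Longrightarrow> x = y"
  by (auto simp: beyond_def)

lemma branches_beyond: "insert s (\<Union>y\<in>B. beyond (y # s)) \<subseteq> beyond s"
  by (simp add: UN_subset_iff beyond_Cons_subset)

lemma other_branches_disjoint:
  "x \<notin> B \<Longrightarrow> insert s (\<Union>y\<in>B. beyond (y # s)) \<inter> beyond (x # s) = {}"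
  using beyond_siblings_disjoint start_not_beyond_Cons by blast

lemma tour_walk:
  assumes "tour B w" "upward B s"
  shows "walk_end s w = s \<and> visited s w \<subseteq> insert s (\<Union>y\<in>B. beyond (y # s))"
  using assms
proof (induction arbitrary: s)
  case (tour_Cons x B h g)
  have x: "push x s = x # s"
    using tour_Cons by (simp add: upward_def)
  have h: "walk_end (x # s) h = x # s"
      "visited (x # s) h \<subseteq> insert (x # s) (\<Union>y \<in> Y - {letter_inv x}. beyond (y # x # s))"
    using tour_Cons.IH(1)[OF upward_child] by blast+
  have g: "walk_end s g = s" "visited s g \<subseteq> insert s (\<Union>y \<in> {y \<in> B. x \<prec> y}. beyond (y # s))"
    using tour_Cons.IH(2)[OF upward_subset[OF tour_Cons.prems]] by blast+
  have "walk_end s (x # h @ letter_inv x # g) = s"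
    using x h(1) g(1) by simp
  moreover have "visited s (x # h @ letter_inv x # g) = visited (x # s) h \<union> visited s g"
    using x h(1) start_in_visited[of s g] end_in_visited[of "x # s" h]
    by (simp add: insert_absorb del: start_in_visited)
  moreover have "visited (x # s) h \<subseteq> beyond (x # s)"
    using h(2) branches_beyond by (rule subset_trans)
  ultimately show ?case
    using g(2) tour_Cons.hyps(1) by blast
qed simp

lemma tour_visited_child:
  assumes "tour (Y - {letter_inv x}) h"
  shows "walk_end (x # s) h = x # s" "visited (x # s) h \<subseteq> beyond (x # s)"
  using tour_walk[OF assms upward_child, of s] branches_beyond by blast+

text \<open>
  The Munn tree of a tour reveals its first branch: the letter is the least \<open>y\<close> whose child is
  visited, the tour inside the branch visits the vertices beyond that child, and the remaining tour
  visits all others.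
\<close>
lemma tour_visited_parts:
  assumes "x \<in> B" "tour (Y - {letter_inv x}) h" "tour {y \<in> B. x \<prec> y} g" "upward B s"
  defines "V \<equiv> visited s (x # h @ letter_inv x # g)"
  shows "V \<inter> beyond (x # s) = visited (x # s) h" "V - beyond (x # s) = visited s g"
    "x # s \<in> V" "y # s \<in> V \<Longrightarrow> y = x \<or> x \<prec> y"
proof -
  have x: "push x s = x # s"
    using assms by (simp add: upward_def)
  have h: "walk_end (x # s) h = x # s" "visited (x # s) h \<subseteq> beyond (x # s)"
    using tour_visited_child assms(2) by auto
  have g: "visited s g \<subseteq> insert s (\<Union>y \<in> {y \<in> B. x \<prec> y}. beyond (y # s))"
    using tour_walk[OF assms(3) upward_subset[OF assms(4)]] by auto
  have V: "V = visited (x # s) h \<union> visited s g"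
    unfolding V_def using x h(1) by (auto simp del: push.simps)
  have disj: "visited s g \<inter> beyond (x # s) = {}"
    using other_branches_disjoint[of x "{y \<in> B. x \<prec> y}" s] g precedes_irrefl by blast
  show "V \<inter> beyond (x # s) = visited (x # s) h" "V - beyond (x # s) = visited s g"
    using V h(2) disj by auto
  show "x # s \<in> V"
    unfolding V by simp
  show "y = x \<or> x \<prec> y" if "y # s \<in> V"
  proof (cases "y # s \<in> visited s g")
    case True
    then obtain z where "x \<prec> z" "y # s \<in> beyond (z # s)"
      using g by auto
    then show ?thesis
      using beyond_siblings_disjoint[of "y # s" y s z] by auto
  next
    case False
    then have "y # s \<in> beyond (x # s)"
      using that V h(2) by auto
    then show ?thesis
      using beyond_siblings_disjoint[of "y # s" y s x] by auto
  qed
qed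

lemma tour_determined:
  assumes "tour B w" "tour B w'" "upward B s" "visited s w = visited s w'"
  shows "w = w'"
  using assms
proof (induction arbitrary: s w')
  case (tour_Nil B)
  from tour_Nil(1) show ?case
  proof cases
    case (tour_Cons x h g)
    then have "x # s \<in> visited s w'"
      using tour_visited_parts(3) tour_Nil.prems by blast
    moreover have "visited s w' = {s}"
      using tour_Nil.prems by simp
    ultimately show ?thesis
      by simp
  qed simp
next
  case (tour_Cons x B h g)
  note parts = tour_visited_parts[OF tour_Cons.hyps(1,3,4) tour_Cons.prems(2)]
  from tour_Cons.prems(1) show ?case
  proof cases
    case tour_Nil
    then have "x # s \<in> {s}"
      using parts(3) tour_Cons.prems(3) by (metis visited.simps(1))
    then show ?thesis
      by simp
  next
    case (tour_Cons x' h' g')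
    note parts' = tour_visited_parts[OF tour_Cons(2,4,5) \<open>upward B s\<close>]
    have V: "visited s (x # h @ letter_inv x # g) = visited s (x' # h' @ letter_inv x' # g')"
      using tour_Cons(1) \<open>visited s (x # h @ letter_inv x # g) = visited s w'\<close> by simp
    have "x' = x \<or> x \<prec> x'" "x = x' \<or> x' \<prec> x"
      using parts(3,4) parts'(3,4) V by metis+
    then have x: "x' = x"
      using precedes_trans[of x x' x] by auto
    have "visited (x # s) h = visited (x # s) h'" "visited s g = visited s g'"
      using parts(1,2) parts'(1,2) V x by metis+
    moreover have "upward {y \<in> B. x \<prec> y} s"
      using \<open>upward B s\<close> by (rule upward_subset) auto
    ultimately have "h = h'" "g = g'"
      using tour_Cons.IH tour_Cons x upward_child by metis+
    then show ?thesis
      using tour_Cons x by simp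
  qed
qed

lemma spine_tour_walk:
  assumes "spine_tour B w xs" "upward B s"
  shows "walk_end s w = rev xs @ s \<and> visited s w \<subseteq> insert s (\<Union>y\<in>B. beyond (y # s))"
  using assms
proof (induction arbitrary: s)
  case (spine_step x B h w xs)
  have x: "push x s = x # s"
    using spine_step by (simp add: upward_def)
  have w: "walk_end (x # s) w = rev xs @ x # s"
      "visited (x # s) w \<subseteq> insert (x # s) (\<Union>y \<in> Y - {letter_inv x}. beyond (y # x # s))"
    using spine_step.IH[OF upward_child] by blast+
  have h: "walk_end s h = s" "visited s h \<subseteq> insert s (\<Union>y \<in> B - {x}. beyond (y # s))"
    using tour_walk[OF spine_step.hyps(3) upward_subset[OF spine_step.prems]] by blast+
  have "walk_end s (h @ x # w) = rev (x # xs) @ s"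
    using x h(1) w(1) by simp
  moreover have "visited s (h @ x # w) = visited s h \<union> visited (x # s) w"
    using x h(1) start_in_visited[of s h] by (auto simp del: start_in_visited)
  moreover have "visited (x # s) w \<subseteq> beyond (x # s)"
    using w(2) branches_beyond by (rule subset_trans)
  ultimately show ?case
    using h(2) spine_step.hyps(1) by blast
qed (use tour_walk in simp)

text \<open>
  The first tour avoids the geodesic edge \<open>x\<close> and the rest of the walk does not come back from it,
  so the vertices visited by the two are separated by that edge.
\<close>
lemma spine_tour_visited_parts:
  assumes "x \<in> B" "tour (B - {x}) h" "spine_tour (Y - {letter_inv x}) w xs" "upward B s"
  defines "V \<equiv> visited s (h @ x # w)"
  shows "V \<inter> beyond (x # s) = visited (x # s) w" "V - beyond (x # s) = visited s h"
proof -
  have x: "push x s = x # s"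
    using assms by (simp add: upward_def)
  have w: "visited (x # s) w \<subseteq> beyond (x # s)"
    using spine_tour_walk[OF assms(3) upward_child, of s] branches_beyond by blast
  have h: "walk_end s h = s" "visited s h \<subseteq> insert s (\<Union>y \<in> B - {x}. beyond (y # s))"
    using tour_walk[OF assms(2) upward_subset[OF assms(4)]] by auto
  have "visited s h \<inter> beyond (x # s) = {}"
    using h(2) other_branches_disjoint[of x "B - {x}" s] by blast
  moreover have "V = visited s h \<union> visited (x # s) w"
    unfolding V_def using x h(1) by (auto simp del: push.simps)
  ultimately show "V \<inter> beyond (x # s) = visited (x # s) w" "V - beyond (x # s) = visited s h"
    using w by auto
qed

lemma spine_tour_determined:
  assumes "spine_tour B w xs" "spine_tour B w' xs" "upward B s" "visited s w = visited s w'"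
  shows "w = w'"
  using assms
proof (induction arbitrary: s w')
  case (spine_end B h)
  then have "tour B w'"
    by (auto elim: spine_tour.cases)
  then show ?case
    using spine_end tour_determined by blast
next
  case (spine_step x B h w xs)
  from spine_step.prems(1) obtain h' w2 where w':
    "w' = h' @ x # w2" "tour (B - {x}) h'" "spine_tour (Y - {letter_inv x}) w2 xs"
    by (auto elim: spine_tour.cases)
  note parts = spine_tour_visited_parts[OF spine_step.hyps(1,3,4) spine_step.prems(2)]
    and parts' = spine_tour_visited_parts[OF spine_step.hyps(1) w'(2,3) spine_step.prems(2)]
  have "visited (x # s) w = visited (x # s) w2" "visited s h = visited s h'"
    using parts parts' spine_step.prems(3) w'(1) by metis+
  moreover have "upward (B - {x}) s"
    using spine_step.prems(2) by (rule upward_subset) auto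
  ultimately have "w = w2" "h = h'"
    using spine_step.IH w' upward_child tour_determined spine_step.hyps(3) by metis+
  then show ?case
    using w' by simp
qed

lemma irreducible_determined:
  assumes "irreducible u" "irreducible v" "same_Munn_tree u v"
  shows "u = v"
proof -
  obtain xs ys where sp: "spine_tour Y u xs" "spine_tour Y v ys"
    using irreducible_spine_tour assms by blast
  have up: "upward Y []"
    by (simp add: upward_def)
  have "visited [] u = visited [] v" "walk_end [] u = walk_end [] v"
    using assms(3) by (simp_all add: same_Munn_tree_def)
  moreover from this have "xs = ys"
    using spine_tour_walk[OF sp(1) up] spine_tour_walk[OF sp(2) up] by simp
  ultimately show ?thesis
    using sp up spine_tour_determined by blast
qed


section \<open>Reduction to normal form\<close>

lemma S_in_FI: "S \<subseteq> generated_congruence Y (free_inverse_relations X)"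
  using relations_a_in_FI[of r X] relations_b_in_FI[of r X] unfolding S_def by (simp add: alphabet)

lemma S_in_lists: "S \<subseteq> lists Y \<times> lists Y"
proof
  fix p assume "p \<in> S"
  then show "p \<in> lists Y \<times> lists Y"
    using S_in_FI generated_congruence_in_lists[of "fst p" "snd p" Y] by (metis mem_Times_iff prod.collapse subsetD)
qed

lemma S_decreasing: "(u, v) \<in> S \<Longrightarrow> (v, u) \<in> deglex r"
  by (auto simp: S_def relations_a_def relations_b_def deglex_def lenlex_conv)

definition reduction :: "('a word \<times> 'a word) set" where
  "reduction = {(a @ u @ b, a @ v @ b) | a b u v. a \<in> lists Y \<and> b \<in> lists Y \<and> (u, v) \<in> S}"

lemma elementary_transformation_eq: "elementary_transformation Y S = reduction \<union> reduction\<inverse>"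
  unfolding elementary_transformation_def reduction_def by blast

lemma reduction_congruent: "(u, v) \<in> reduction \<Longrightarrow> (u, v) \<in> generated_congruence Y S"
  using S_in_lists by (auto simp: reduction_def intro: elementary_transformation_congruent)

lemma reduction_in_lists: "(u, v) \<in> reduction \<Longrightarrow> u \<in> lists Y \<and> v \<in> lists Y"
  using reduction_congruent generated_congruence_in_lists by blast

lemma reduction_decreasing:
  assumes "(u, v) \<in> reduction"
  shows "(v, u) \<in> deglex r"
proof -
  obtain a b p q where "u = a @ p @ b" "v = a @ q @ b" "(p, q) \<in> S"
    using assms by (auto simp: reduction_def)
  then show ?thesis
    using S_decreasing lenlex_append1[of q p "r - Id" b b]
    by (auto simp: deglex_def irrefl_def)
qed

lemma reduction_same_Munn_tree: "(u, v) \<in> reduction \<Longrightarrow> same_Munn_tree u v"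
  using reduction_congruent generated_congruence_mono[OF S_in_FI] free_inverse_same_Munn_tree
  by blast

lemma irreducible_normal_form:
  assumes "w \<in> lists Y"
  shows "\<exists>n. irreducible n \<and> (w, n) \<in> reduction\<^sup>*"
  using wf_deglex assms
proof (induction w rule: wf_induct_rule)
  case (less w)
  show ?case
  proof (cases "irreducible w")
    case False
    then obtain a b u v where "(u, v) \<in> S" "w = a @ u @ b"
      using less.prems by (auto simp: irreducible_def)
    then have "(w, a @ v @ b) \<in> reduction"
      using less.prems by (auto simp: reduction_def)
    then show ?thesis
      using less.IH reduction_decreasing reduction_in_lists
      by (meson converse_rtrancl_into_rtrancl)
  qed auto
qed

lemma same_Munn_tree_trans: "same_Munn_tree u v \<Longrightarrow> same_Munn_tree v w \<Longrightarrow> same_Munn_tree u w"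
  and same_Munn_tree_sym: "same_Munn_tree u v \<Longrightarrow> same_Munn_tree v u"
  by (auto simp: same_Munn_tree_def)

lemma reductions_same_Munn_tree: "(u, v) \<in> reduction\<^sup>* \<Longrightarrow> same_Munn_tree u v"
  by (induction rule: rtrancl_induct)
    (auto simp: same_Munn_tree_def dest: reduction_same_Munn_tree)

text \<open>
  Reductions preserve the Munn tree, so the normal forms of \<open>u\<close> and \<open>v\<close> have the same one.
\<close>
lemma joinable_if_same_Munn_tree:
  assumes "u \<in> lists Y" "v \<in> lists Y" "same_Munn_tree u v"
  obtains n where "(u, n) \<in> reduction\<^sup>*" "(v, n) \<in> reduction\<^sup>*"
proof -
  obtain m n where mn: "irreducible m" "(u, m) \<in> reduction\<^sup>*" "irreducible n" "(v, n) \<in> reduction\<^sup>*"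
    using irreducible_normal_form assms by blast
  then have "same_Munn_tree m n"
    using assms(3) reductions_same_Munn_tree same_Munn_tree_trans same_Munn_tree_sym by blast
  then have "m = n"
    using mn irreducible_determined by blast
  then show thesis
    using that mn by blast
qed

lemma reductions_congruent:
  "(u, v) \<in> reduction\<^sup>* \<Longrightarrow> u \<in> lists Y \<Longrightarrow> (u, v) \<in> generated_congruence Y S"
  by (induction rule: rtrancl_induct)
    (auto intro: generated_congruence.refl generated_congruence.trans reduction_congruent)

lemma congruences_equal:
  "generated_congruence Y (free_inverse_relations X) = generated_congruence Y S"
proof
  show "generated_congruence Y S \<subseteq> generated_congruence Y (free_inverse_relations X)"
    by (rule generated_congruence_mono[OF S_in_FI])
  show "generated_congruence Y (free_inverse_relations X) \<subseteq> generated_congruence Y S"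
  proof (rule subrelI)
    fix u v assume uv: "(u, v) \<in> generated_congruence Y (free_inverse_relations X)"
    then have lists: "u \<in> lists Y" "v \<in> lists Y"
      using generated_congruence_in_lists by blast+
    with uv obtain n where "(u, n) \<in> reduction\<^sup>*" "(v, n) \<in> reduction\<^sup>*"
      using free_inverse_same_Munn_tree joinable_if_same_Munn_tree by blast
    then show "(u, v) \<in> generated_congruence Y S"
      using lists reductions_congruent by (blast intro: generated_congruence.trans generated_congruence.sym)
  qed
qed

lemma reductions_below:
  assumes "(p, n) \<in> reduction\<^sup>*" "p \<in> B" "B = {v \<in> lists Y. (v, w) \<in> deglex r}"
  shows "n \<in> B \<and> (p, n) \<in> (reduction \<inter> B \<times> B)\<^sup>*"
  using assms(1)
proof induction
  case (step m n)
  then have "n \<in> B"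
    using assms(3) reduction_in_lists reduction_decreasing deglex_trans by (blast dest: transD)
  with step show ?case
    by (auto intro: rtrancl_into_rtrancl)
qed (use assms(2) in auto)

text \<open>
  Since \<open>p\<close> and \<open>q\<close> are smaller than \<open>w\<close>, the whole path from \<open>p\<close> down to the common normal
  form and back up to \<open>q\<close> is smaller than \<open>w\<close>.
\<close>
lemma critical_pair_trivial:
  assumes "(w, p) \<in> reduction" "(w, q) \<in> reduction"
  shows "congruent_mod (deglex r) Y S w p q"
proof -
  define B where "B = {v \<in> lists Y. (v, w) \<in> deglex r}"
  let ?T = "elementary_transformation Y S \<inter> B \<times> B"
  have pq: "p \<in> B" "q \<in> B"
    unfolding B_def using assms reduction_in_lists reduction_decreasing by blast+
  have "same_Munn_tree p q"
    using assms[THEN reduction_same_Munn_tree] same_Munn_tree_trans same_Munn_tree_sym by metis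
  then obtain n where "(p, n) \<in> reduction\<^sup>*" "(q, n) \<in> reduction\<^sup>*"
    using joinable_if_same_Munn_tree assms[THEN reduction_in_lists] by metis
  then have n: "(p, n) \<in> (reduction \<inter> B \<times> B)\<^sup>*" "(q, n) \<in> (reduction \<inter> B \<times> B)\<^sup>*"
    using reductions_below[OF _ _ B_def] pq by simp_all
  have "(reduction \<inter> B \<times> B)\<^sup>* \<subseteq> ?T\<^sup>*"
    unfolding elementary_transformation_eq by (intro rtrancl_mono) blast
  then have "(p, n) \<in> ?T\<^sup>*" "(q, n) \<in> ?T\<^sup>*"
    using n by blast+
  moreover have "sym ?T"
    unfolding elementary_transformation_eq sym_def by blast
  then have "sym (?T\<^sup>*)"
    by (rule sym_rtrancl)
  ultimately have "(p, q) \<in> ?T\<^sup>*"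
    by (meson rtrancl_trans symD)
  then show ?thesis
    using B_def pq(1) by (rule congruent_mod_if_rtrancl)
qed

lemma compositions_are_critical_pairs:
  assumes "(w, p, q) \<in> intersection_compositions Y S \<union> inclusion_compositions Y S"
  shows "(w, p) \<in> reduction \<and> (w, q) \<in> reduction"
  using assms
proof
  assume "(w, p, q) \<in> intersection_compositions Y S"
  then obtain u v u' v' a b where
    "(u, v) \<in> S" "(u', v') \<in> S" "a \<in> lists Y" "b \<in> lists Y" "w = u @ b" "w = a @ u'"
    "p = v @ b" "q = a @ v'"
    unfolding intersection_compositions_def by blast
  moreover from this have "([] @ u @ b, [] @ v @ b) \<in> reduction" "(a @ u' @ [], a @ v' @ []) \<in> reduction"
    unfolding reduction_def by blast+
  ultimately show ?thesis
    by simp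
next
  assume "(w, p, q) \<in> inclusion_compositions Y S"
  then obtain u v u' v' a b where
    "(u, v) \<in> S" "(u', v') \<in> S" "a \<in> lists Y" "b \<in> lists Y" "w = u" "w = a @ u' @ b"
    "p = v" "q = a @ v' @ b"
    unfolding inclusion_compositions_def by blast
  moreover from this have "([] @ u @ [], [] @ v @ []) \<in> reduction" "(a @ u' @ b, a @ v' @ b) \<in> reduction"
    unfolding reduction_def by blast+
  ultimately show ?thesis
    by simp
qed

lemma Groebner_Shirshov: "Groebner_Shirshov_basis (deglex r) Y S"
  unfolding Groebner_Shirshov_basis_def
  using S_in_lists S_decreasing critical_pair_trivial compositions_are_critical_pairs by blast

end

theorem theorem4p1:
  fixes X :: "'a set"
    and Y :: "'a letter set"
    and r :: "('a letter \<times> 'a letter) set"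
    and S :: "('a word \<times> 'a word) set"
  assumes "Y = alphabet X"
    and "well_order_on Y r"
    and "S = relations_a r Y \<union> relations_b r Y"
  shows "generated_congruence Y (free_inverse_relations X) = generated_congruence Y S
       \<and> Groebner_Shirshov_basis (deglex r) Y S"
proof -
  interpret ordered_alphabet X Y r
    using assms(1,2) by unfold_locales
  have "S = ordered_alphabet.S Y r"
    by (simp add: assms(3) S_def)
  then show ?thesis
    using congruences_equal Groebner_Shirshov by simp
qed

end
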